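(* Every class of graphs of bounded double-star partition number admits an implicit representation. In particular, every class of graphs of bounded $h$-index admits an implicit representation.
   Context: All graphs are finite and simple. A homogeneous set is a set of vertices that is either a clique or an independent set. An unbalanced (induced) copy of $2K_{1,p}$ in a bipartite graph $G=(A,B,E)$ given with its bipartition is an induced copy of $2K_{1,p}$ (the disjoint union of two stars with $p$ leaves) in which the centres of both stars belong to the same part: i.e. two distinct vertices $c_1,c_2$ in one part and disjoint $p$-element subsets $S_1,S_2$ of the other part such that $c_i$ is adjacent to all vertices of $S_i$ and to no vertex of $S_{3-i}$, for $i=1,2$. A class $\mathcal X$ of graphs is of bounded double-star partition number if there are constants $k$ and $p$ such that the vertex set of every graph in $\mathcal X$ can be partitioned into at most $k$ homogeneous subsets such that, for any pair of distinct subsets, the bipartite graph formed by the edges between them (with the two subsets as its parts) contains no unbalanced copy of $2K_{1,p}$. The $h$-index of a graph $G$ is the largest $k\ge 0$ such that $G$ has $k$ vertices of degree at least $k$; a class has bounded $h$-index if the $h$-indices of its members are bounded by a constant. A class $\mathcal X$ of graphs admits an implicit representation if there are a constant $c$ and a function $f:\{0,1\}^*\times\{0,1\}^*\to\{0,1\}$ (depending only on $\mathcal X$) such that for every $n\ge 2$ and every $n$-vertex graph $G\in\mathcal X$ one can assign to each vertex $x$ of $G$ a binary code $\ell(x)$ of length at most $c\log n$ so that distinct vertices $x,y$ are adjacent in $G$ if and only if $f(\ell(x),\ell(y))=1$. *)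

theory Defs
  imports Complex_Main "HOL-Library.Disjoint_Sets" "Graph_Theory.Pair_Digraph"
begin

text \<open>
  A finite simple graph is a \<^locale>\<open>pair_graph\<close>: finite, loop-free, and every undirected edge
  is represented by its two opposite arcs. A class of graphs is a set of such graphs over a common
  vertex type; it is not required to be closed under isomorphism or under induced subgraphs.
\<close>

definition homogeneous :: "'a pair_pre_digraph \<Rightarrow> 'a set \<Rightarrow> bool" where
  "homogeneous G S \<longleftrightarrow> S \<subseteq> pverts G \<and>
     ((\<forall>x\<in>S. \<forall>y\<in>S. x \<noteq> y \<longrightarrow> (x, y) \<in> parcs G) \<or>
      (\<forall>x\<in>S. \<forall>y\<in>S. x \<noteq> y \<longrightarrow> (x, y) \<notin> parcs G))"

definition bipartite_between :: "'a pair_pre_digraph \<Rightarrow> 'a set \<Rightarrow> 'a set \<Rightarrow> 'a pair_pre_digraph" where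
  "bipartite_between G A B =
     \<lparr> pverts = A \<union> B, parcs = parcs G \<inter> (A \<times> B \<union> B \<times> A) \<rparr>"

text \<open>
  \<open>unbalanced_double_star H A B p\<close>: the bipartite graph \<open>H\<close> with parts \<open>A\<close> and \<open>B\<close> contains an
  unbalanced induced copy of $2K_{1,p}$. The part \<open>X\<close> containing both centres may be either of the
  two. Vertices in the same part are never adjacent in \<open>H\<close>, so only adjacency between centres and
  leaves has to be prescribed for the copy to be induced.
\<close>

definition unbalanced_double_star ::
    "'a pair_pre_digraph \<Rightarrow> 'a set \<Rightarrow> 'a set \<Rightarrow> nat \<Rightarrow> bool" where
  "unbalanced_double_star H A B p \<longleftrightarrow>
     (\<exists>(X, Y) \<in> {(A, B), (B, A)}. \<exists>c1\<in>X. \<exists>c2\<in>X. \<exists>S1 S2.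
        c1 \<noteq> c2 \<and> S1 \<subseteq> Y \<and> S2 \<subseteq> Y \<and> S1 \<inter> S2 = {} \<and>
        finite S1 \<and> card S1 = p \<and> finite S2 \<and> card S2 = p \<and>
        (\<forall>s\<in>S1. (c1, s) \<in> parcs H \<and> (c2, s) \<notin> parcs H) \<and>
        (\<forall>s\<in>S2. (c2, s) \<in> parcs H \<and> (c1, s) \<notin> parcs H))"

definition bounded_double_star_partition_number :: "'a pair_pre_digraph set \<Rightarrow> bool" where
  "bounded_double_star_partition_number \<X> \<longleftrightarrow>
     (\<exists>k p. \<forall>G\<in>\<X>. \<exists>P. partition_on (pverts G) P \<and> finite P \<and> card P \<le> k \<and>
        (\<forall>S\<in>P. homogeneous G S) \<and>
        (\<forall>A\<in>P. \<forall>B\<in>P. A \<noteq> B \<longrightarrow> \<not> unbalanced_double_star (bipartite_between G A B) A B p))"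

text \<open>In a \<^locale>\<open>pair_graph\<close> the undirected degree of a vertex is its out-degree.\<close>

definition h_index :: "'a pair_pre_digraph \<Rightarrow> nat" where
  "h_index G = (GREATEST k. \<exists>S \<subseteq> pverts G. finite S \<and> card S = k \<and>
     (\<forall>v\<in>S. k \<le> out_degree (with_proj G) v))"

definition bounded_h_index :: "'a pair_pre_digraph set \<Rightarrow> bool" where
  "bounded_h_index \<X> \<longleftrightarrow> (\<exists>k. \<forall>G\<in>\<X>. h_index G \<le> k)"

text \<open>
  Binary words are lists of booleans. The base of the logarithm is immaterial, since it is
  absorbed by the constant \<open>c\<close>.
\<close>

definition admits_implicit_representation :: "'a pair_pre_digraph set \<Rightarrow> bool" where
  "admits_implicit_representation \<X> \<longleftrightarrow>
     (\<exists>(c::real) (f :: bool list \<Rightarrow> bool list \<Rightarrow> bool).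
        \<forall>G\<in>\<X>. card (pverts G) \<ge> 2 \<longrightarrow>
          (\<exists>l :: 'a \<Rightarrow> bool list.
             (\<forall>x\<in>pverts G. real (length (l x)) \<le> c * log 2 (real (card (pverts G)))) \<and>
             (\<forall>x\<in>pverts G. \<forall>y\<in>pverts G. x \<noteq> y \<longrightarrow>
                ((x, y) \<in> parcs G \<longleftrightarrow> f (l x) (l y)))))"

end

theory Submission
  imports Defs
begin

text \<open>
  Between two parts \<open>A\<close> and \<open>B\<close> without unbalanced double stars, the neighbourhoods on either side
  are nested up to fewer than \<open>p\<close> vertices. Sort \<open>B\<close> by degree and compare every row \<open>a\<close> with a final
  segment of \<open>B\<close> of length \<open>deg a\<close>. A row has as many neighbours outside this segment as it has
  non-neighbours inside, and double counting between these two kinds of exceptions shows that each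
  exceptional pair can be charged to one of its ends so that no vertex is charged more than \<open>4 * p\<close>
  times. Hence boundedly many numbers per vertex determine all adjacencies. For bounded h-index, a
  vertex of large degree stores its neighbours of large degree and any other vertex stores all of
  its neighbours.
\<close>

section \<open>Thresholds and exceptional pairs between two vertex sets\<close>

lemma ex_monotone_enumeration:
  fixes g :: "'b \<Rightarrow> nat"
  assumes "finite B"
  shows "\<exists>pos. bij_betw pos B {..<card B} \<and> (\<forall>b\<in>B. \<forall>c\<in>B. pos b < pos c \<longrightarrow> g b \<le> g c)"
  using assms
proof (induction rule: finite_ranking_induct[where f = g])
  case empty
  show ?case by (intro exI[of _ "\<lambda>_. 0"]) (simp add: bij_betw_def)
next
  case (insert x S)
  show ?case
  proof (cases "x \<in> S")
    case True
    with insert.IH show ?thesis by (simp add: insert_absorb)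
  next
  case new: False
  obtain pos where pos: "bij_betw pos S {..<card S}"
      "\<forall>b\<in>S. \<forall>c\<in>S. pos b < pos c \<longrightarrow> g b \<le> g c" using insert.IH by blast
  \<comment> \<open>The ranking induction inserts \<open>x\<close> only when \<open>g x\<close> is
    at least every earlier value, so \<open>x\<close> can take the last position.\<close>
  define pos' where "pos' = pos(x := card S)"
  have lt: "pos y < card S" if "y \<in> S" for y
    using bij_betwE[OF pos(1)] that by simp
  have pos'_old: "pos' y = pos y" if "y \<in> S" for y using that new by (auto simp: pos'_def)
  then have "bij_betw pos' S {..<card S}"
    using pos(1) bij_betw_cong[of S pos' pos] by blast
  then have "bij_betw pos' (S \<union> {x}) ({..<card S} \<union> {pos' x})"
    using new by (intro notIn_Un_bij_betw) (auto simp: pos'_def)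
  moreover have "{..<card S} \<union> {pos' x} = {..<card (insert x S)}" "S \<union> {x} = insert x S"
    using insert.hyps new by (auto simp: pos'_def)
  moreover have "g b \<le> g c" if "b \<in> insert x S" "c \<in> insert x S" "pos' b < pos' c" for b c
  proof (cases "c = x")
    case True
    with that(1) insert.hyps(2) show ?thesis by blast
  next
    case False
    with that(2) have "c \<in> S" by simp
    then have "pos' b < card S" using that(3) lt pos'_old by fastforce
    then have "b \<in> S" using that(1) by (auto simp: pos'_def)
    with \<open>c \<in> S\<close> that(3) pos(2) show ?thesis by (simp add: pos'_old)
  qed
  ultimately show ?thesis by auto
  qed
qed

lemma card_filter_split:
  assumes "finite X"
  shows "card {x\<in>X. P x} = card {x\<in>X. P x \<and> Q x} + card {x\<in>X. P x \<and> \<not> Q x}"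
proof -
  have "{x\<in>X. P x} = {x\<in>X. P x \<and> Q x} \<union> {x\<in>X. P x \<and> \<not> Q x}" by blast
  also have "card \<dots> = card {x\<in>X. P x \<and> Q x} + card {x\<in>X. P x \<and> \<not> Q x}"
    using assms by (intro card_Un_disjoint) auto
  finally show ?thesis .
qed

text \<open>
  An exception is charged to its row \<open>a\<close> unless this row has more than \<open>2 * p\<close> exceptions. If a column
  \<open>b\<close> were charged more than \<open>2 * p\<close> times, let \<open>m\<close> be the largest row charging it: the columns in
  \<open>D m\<close> contain most of the rows charging \<open>b\<close>, whereas each of these rows meets fewer than \<open>p\<close> of
  the columns in \<open>D m\<close>.
\<close>

lemma exceptions_orientation:
  fixes R E D :: "'a \<Rightarrow> 'b \<Rightarrow> bool" and w :: "'a \<Rightarrow> nat"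
  assumes fin: "finite A" "finite B"
    and rows: "\<And>a a'. a \<in> A \<Longrightarrow> a' \<in> A \<Longrightarrow> w a' \<le> w a \<Longrightarrow>
      card {b\<in>B. R a' b \<and> \<not> R a b} < p"
    and E: "\<And>a b. E a b \<Longrightarrow> a \<in> A \<and> b \<in> B \<and> R a b"
    and D: "\<And>a b. D a b \<Longrightarrow> b \<in> B \<and> \<not> R a b"
    and balance: "\<And>a. a \<in> A \<Longrightarrow> card {b. E a b} = card {b. D a b}"
    and cols: "\<And>a b c. E a b \<Longrightarrow> D a c \<Longrightarrow> card {x\<in>A. R x b \<and> \<not> R x c} < p"
  shows "\<exists>S T. (\<forall>a. card (S a) \<le> 2 * p \<and> S a \<subseteq> B) \<and> (\<forall>b. card (T b) \<le> 2 * p \<and> T b \<subseteq> A) \<and>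
           (\<forall>a b. E a b \<longleftrightarrow> b \<in> S a \<or> a \<in> T b)"
proof -
  define S where "S a = (if card {b. E a b} \<le> 2 * p then {b. E a b} else {})" for a
  define T where "T b = {a. E a b \<and> \<not> card {b. E a b} \<le> 2 * p}" for b
  have T_sub: "T b \<subseteq> A" for b using E by (auto simp: T_def)
  have "card (T b) \<le> 2 * p" for b
  proof (rule ccontr)
    assume "\<not> card (T b) \<le> 2 * p"
    then have large: "2 * p < card (T b)" by simp
    then have "finite (T b)" "T b \<noteq> {}" by (auto intro: card_ge_0_finite)
    then have "Max (w ` T b) \<in> w ` T b" by (intro Max_in) auto
    then obtain m where "m \<in> T b" "w m = Max (w ` T b)" by auto
    then have m: "m \<in> T b" "\<And>a. a \<in> T b \<Longrightarrow> w a \<le> w m"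
      using \<open>finite (T b)\<close> by auto
    \<comment> \<open>Exactly \<open>2 * p\<close> rows are kept: fewer than \<open>p\<close> of
      them can miss a given column of \<open>C\<close>, which leaves at least \<open>p + 1\<close>
      rows meeting it.\<close>
    obtain A0 where A0: "A0 \<subseteq> T b" "card A0 = 2 * p" "finite A0"
      using large obtain_subset_with_card_n[of "2 * p" "T b"] by auto
    define C where "C = {c. D m c}"
    have mA: "m \<in> A" and Emb: "E m b" using m T_sub by (auto simp: T_def)
    have "finite C" using D fin by (auto simp: C_def intro: finite_subset[of _ B])
    \<comment> \<open>The row \<open>m\<close> charges \<open>b\<close>, so it has more than
      \<open>2 * p\<close> exceptions, and \<open>balance\<close> carries this over to
      \<open>D m\<close>.\<close>
    have C: "2 * p < card C" using m(1) balance[OF mA] by (auto simp: T_def C_def)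
    \<comment> \<open>Comparing \<open>m\<close> with itself bounds the size 0 of the empty set
      strictly by \<open>p\<close>.\<close>
    have pos: "p > 0" using rows[OF mA mA] by auto
    have le: "card {c\<in>C. R a c} \<le> p" if "a \<in> A0" for a
    proof -
      have "card {c\<in>C. R a c} \<le> card {b\<in>B. R a b \<and> \<not> R m b}"
        using D fin by (intro card_mono) (auto simp: C_def)
      also have "\<dots> < p" using that A0 T_sub m by (intro rows mA) auto
      finally show ?thesis by simp
    qed
    have ge: "card {a\<in>A0. R a c} \<ge> p + 1" if "c \<in> C" for c
    proof -
      have "card {a\<in>A0. \<not> R a c} \<le> card {x\<in>A. R x b \<and> \<not> R x c}"
        using A0 E fin by (intro card_mono) (auto simp: T_def)
      also have "\<dots> < p" using that Emb by (intro cols) (auto simp: C_def)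
      finally have "card {a\<in>A0. \<not> R a c} < p" .
      moreover have "card A0 = card {a\<in>A0. R a c} + card {a\<in>A0. \<not> R a c}"
        using card_filter_split[OF A0(3), of "\<lambda>_. True"] by simp
      ultimately show ?thesis using A0(2) by simp
    qed
    \<comment> \<open>Double counting of the related pairs in \<open>A0\<close> and
      \<open>C\<close>: by columns there are at least \<open>2 * p * (p + 1)\<close>, by rows at
      most \<open>2 * p * p\<close>.\<close>
    have "2 * p * (p + 1) \<le> card C * (p + 1)" using C by (intro mult_right_mono) auto
    also have "\<dots> \<le> (\<Sum>c\<in>C. card {a\<in>A0. R a c})"
      using sum_bounded_below[of C "p + 1" "\<lambda>c. card {a\<in>A0. R a c}"] ge by simp
    also have "\<dots> = (\<Sum>a\<in>A0. card {c\<in>C. R a c})"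
      using \<open>finite C\<close> A0(3) by (intro sum_multicount_gen[symmetric]) auto
    also have "\<dots> \<le> 2 * p * p"
      using sum_bounded_above[of A0 "\<lambda>a. card {c\<in>C. R a c}" p] le A0(2) by simp
    finally show False using pos by simp
  qed
  moreover have "card (S a) \<le> 2 * p" "S a \<subseteq> B" for a using E by (auto simp: S_def)
  moreover have "E a b \<longleftrightarrow> b \<in> S a \<or> a \<in> T b" for a b
    by (auto simp: S_def T_def)
  ultimately show ?thesis using T_sub by (intro exI[of _ S] exI[of _ T]) auto
qed

definition almost_nested :: "nat \<Rightarrow> ('a \<Rightarrow> 'b \<Rightarrow> bool) \<Rightarrow> 'a set \<Rightarrow> 'b set \<Rightarrow> bool" where
  "almost_nested p R A B \<longleftrightarrow>
     (\<forall>a\<in>A. \<forall>a'\<in>A. card {b\<in>B. R a b \<and> \<not> R a' b} < p \<or> card {b\<in>B. R a' b \<and> \<not> R a b} < p)"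

text \<open>Both degrees contain the common neighbours, so the row of smaller degree also has the
  smaller one-sided difference. Whichever difference is below \<open>p\<close>, this one is.\<close>

lemma almost_nested_degree:
  assumes "almost_nested p R A B" "finite B" "a \<in> A" "a' \<in> A"
    and "card {b\<in>B. R a' b} \<le> card {b\<in>B. R a b}"
  shows "card {b\<in>B. R a' b \<and> \<not> R a b} < p"
proof -
  have split: "card {b\<in>B. R x b} = card {b\<in>B. R x b \<and> R y b} + card {b\<in>B. R x b \<and> \<not> R y b}" for x y
    using \<open>finite B\<close> by (rule card_filter_split)
  have "{b\<in>B. R a b \<and> R a' b} = {b\<in>B. R a' b \<and> R a b}" by blast
  then show ?thesis
    using assms split[of a a'] split[of a' a] unfolding almost_nested_def by fastforce
qed

text \<open>A recorded pair flips the answer of the threshold test, so neighbours below and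
  non-neighbours above the threshold can share the same sets. Each such pair is recorded at one of
  its ends at least, with at most \<open>d\<close> records per vertex.\<close>

definition threshold_scheme ::
    "nat \<Rightarrow> ('a \<Rightarrow> 'b \<Rightarrow> bool) \<Rightarrow> 'a set \<Rightarrow> 'b set \<Rightarrow>
      ('a \<Rightarrow> nat) \<Rightarrow> ('b \<Rightarrow> nat) \<Rightarrow> ('a \<Rightarrow> 'b set) \<Rightarrow> ('b \<Rightarrow> 'a set) \<Rightarrow> bool" where
  "threshold_scheme d R A B u v S T \<longleftrightarrow>
     (\<forall>a\<in>A. u a \<le> card B) \<and> (\<forall>b\<in>B. v b \<le> card B) \<and>
     (\<forall>a. card (S a) \<le> d \<and> S a \<subseteq> B) \<and> (\<forall>b. card (T b) \<le> d \<and> T b \<subseteq> A) \<and>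
     (\<forall>a\<in>A. \<forall>b\<in>B. R a b \<longleftrightarrow> ((u a \<le> v b) \<noteq> (b \<in> S a \<or> a \<in> T b)))"

lemma threshold_with_exceptions:
  fixes R :: "'a \<Rightarrow> 'b \<Rightarrow> bool"
  assumes fin: "finite A" "finite B"
    and rows: "almost_nested p R A B" and cols: "almost_nested p (\<lambda>b a. R a b) B A"
  shows "\<exists>u v S T. threshold_scheme (4 * p) R A B u v S T"
proof -
  obtain v where v: "bij_betw v B {..<card B}"
    and v_mono: "\<And>b c. b \<in> B \<Longrightarrow> c \<in> B \<Longrightarrow> v b < v c \<Longrightarrow> card {a\<in>A. R a b} \<le> card {a\<in>A. R a c}"
    using ex_monotone_enumeration[OF fin(2), of "\<lambda>b. card {a\<in>A. R a b}"] by blast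
  define d where "d a = card {b\<in>B. R a b}" for a
  \<comment> \<open>With this value the columns \<open>b\<close> satisfying
    \<open>u a \<le> v b\<close> are exactly the last \<open>d a\<close> columns in the order of
    \<open>v\<close>.\<close>
  define u where "u a = card B - d a" for a
  have d_le: "d a \<le> card B" for a unfolding d_def using fin by (intro card_mono) auto
  define E where "E a b \<longleftrightarrow> a \<in> A \<and> b \<in> B \<and> R a b \<and> v b < u a" for a b
  define D where "D a b \<longleftrightarrow> a \<in> A \<and> b \<in> B \<and> \<not> R a b \<and> u a \<le> v b" for a b
  \<comment> \<open>The neighbourhood of \<open>a\<close> and its final segment both have
    \<open>d a\<close> elements, so their two differences have equal size.\<close>
  have balance: "card {b. E a b} = card {b. D a b}" if "a \<in> A" for a
  proof -
    have "{b. E a b} = {b\<in>B. R a b \<and> \<not> u a \<le> v b}" "{b. D a b} = {b\<in>B. u a \<le> v b \<and> \<not> R a b}"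
      "{b\<in>B. R a b \<and> u a \<le> v b} = {b\<in>B. u a \<le> v b \<and> R a b}"
      using that by (auto simp: E_def D_def)
    then have "card {b. E a b} + card {b\<in>B. u a \<le> v b} = card {b. D a b} + d a"
      unfolding d_def
      using card_filter_split[OF fin(2), of "\<lambda>b. R a b" "\<lambda>b. u a \<le> v b"]
        card_filter_split[OF fin(2), of "\<lambda>b. u a \<le> v b" "\<lambda>b. R a b"] by simp
    moreover have "card {b\<in>B. u a \<le> v b} = d a"
    proof -
      have "card {b\<in>B. u a \<le> v b} = card (v ` {b\<in>B. u a \<le> v b})"
        using v by (intro card_image[symmetric]) (auto simp: bij_betw_def inj_on_def)
      also have "v ` {b\<in>B. u a \<le> v b} = {y \<in> v ` B. u a \<le> y}" by blast
      also have "\<dots> = {u a..<card B}" using v by (auto simp: bij_betw_def)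
      finally show ?thesis using d_le[of a] by (simp add: u_def)
    qed
    ultimately show ?thesis by simp
  qed
  \<comment> \<open>Here \<open>v b < u a \<le> v c\<close>, so \<open>b\<close> has at most the
    degree of \<open>c\<close>, and almost nestedness of the columns applies.\<close>
  have cross: "card {a\<in>A. R a b \<and> \<not> R a c} < p" if "E a b" "D a c" for a b c
    using that almost_nested_degree[OF cols fin(1), of c b] v_mono[of b c]
    by (auto simp: E_def D_def)
  have "\<exists>S T. (\<forall>a. card (S a) \<le> 2 * p \<and> S a \<subseteq> B) \<and> (\<forall>b. card (T b) \<le> 2 * p \<and> T b \<subseteq> A) \<and>
           (\<forall>a b. E a b \<longleftrightarrow> b \<in> S a \<or> a \<in> T b)"
  proof (rule exceptions_orientation[where R = R and D = D and w = d, OF fin _ _ _ balance])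
    show "card {x\<in>A. R x b \<and> \<not> R x c} < p" if "E a b" "D a c" for a b c
      by (rule cross[OF that])
    show "card {b\<in>B. R a' b \<and> \<not> R a b} < p" if "a \<in> A" "a' \<in> A" "d a' \<le> d a" for a a'
      using almost_nested_degree[OF rows fin(2)] that by (simp add: d_def)
  qed (simp_all add: E_def D_def)
  then obtain S1 T1 where ST1: "\<And>a. card (S1 a) \<le> 2 * p" "\<And>a. S1 a \<subseteq> B"
      "\<And>b. card (T1 b) \<le> 2 * p" "\<And>b. T1 b \<subseteq> A" "\<And>a b. E a b \<longleftrightarrow> b \<in> S1 a \<or> a \<in> T1 b"
    by metis
  \<comment> \<open>The bipartite complement is almost nested in the reverse order, and it exchanges the two
    kinds of exceptions.\<close>
  have rows': "card {b\<in>B. \<not> R a' b \<and> \<not> \<not> R a b} < p" if "a \<in> A" "a' \<in> A" "u a' \<le> u a" for a a'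
  proof -
    have "d a \<le> d a'" using that d_le[of a] d_le[of a'] by (simp add: u_def)
    then have "card {b\<in>B. R a b \<and> \<not> R a' b} < p"
      using that almost_nested_degree[OF rows fin(2)] by (simp add: d_def)
    then show ?thesis by (simp add: conj_commute)
  qed
  have cross': "card {a\<in>A. \<not> R a b \<and> \<not> \<not> R a c} < p" if "D a b" "E a c" for a b c
    using cross[OF that(2,1)] by (simp add: conj_commute)
  have "\<exists>S T. (\<forall>a. card (S a) \<le> 2 * p \<and> S a \<subseteq> B) \<and> (\<forall>b. card (T b) \<le> 2 * p \<and> T b \<subseteq> A) \<and>
           (\<forall>a b. D a b \<longleftrightarrow> b \<in> S a \<or> a \<in> T b)"
  proof (rule exceptions_orientation[where R = "\<lambda>a b. \<not> R a b" and D = E and w = u,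
        OF fin rows' _ _ balance[symmetric]])
    show "card {x\<in>A. \<not> R x b \<and> \<not> \<not> R x c} < p" if "D a b" "E a c" for a b c
      by (rule cross'[OF that])
  qed (simp_all add: E_def D_def)
  then obtain S2 T2 where ST2: "\<And>a. card (S2 a) \<le> 2 * p" "\<And>a. S2 a \<subseteq> B"
      "\<And>b. card (T2 b) \<le> 2 * p" "\<And>b. T2 b \<subseteq> A" "\<And>a b. D a b \<longleftrightarrow> b \<in> S2 a \<or> a \<in> T2 b"
    by metis
  define S where "S a = S1 a \<union> S2 a" for a
  define T where "T b = T1 b \<union> T2 b" for b
  have S: "card (S a) \<le> 4 * p" "S a \<subseteq> B" for a
    using ST1(1,2)[of a] ST2(1,2)[of a] card_Un_le[of "S1 a" "S2 a"] by (auto simp: S_def)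
  have T: "card (T b) \<le> 4 * p" "T b \<subseteq> A" for b
    using ST1(3,4)[of b] ST2(3,4)[of b] card_Un_le[of "T1 b" "T2 b"] by (auto simp: T_def)
  have exc: "b \<in> S a \<or> a \<in> T b \<longleftrightarrow> E a b \<or> D a b" for a b
    using ST1(5)[of a b] ST2(5)[of a b] by (auto simp: S_def T_def)
  have "R a b \<longleftrightarrow> ((u a \<le> v b) \<noteq> (b \<in> S a \<or> a \<in> T b))" if "a \<in> A" "b \<in> B" for a b
    using that unfolding exc E_def D_def by auto
  moreover have "v b \<le> card B" if "b \<in> B" for b using bij_betwE[OF v] that by (auto intro: less_imp_le)
  ultimately show ?thesis
    using S T by (intro exI[of _ u] exI[of _ v] exI[of _ S] exI[of _ T]) (auto simp: threshold_scheme_def u_def)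
qed

section \<open>Self-delimiting binary codes for lists of numbers\<close>

text \<open>Binary digits from the least significant one on, each preceded by the flag
  \<open>True\<close>; a single \<open>False\<close> ends the word. The flags make the code
  prefix-free.\<close>

fun nat_code :: "nat \<Rightarrow> bool list" where
  "nat_code n = (if n = 0 then [False] else True # odd n # nat_code (n div 2))"

declare nat_code.simps [simp del]

lemma nat_code_prefix_free: "nat_code m @ xs = nat_code n @ ys \<Longrightarrow> m = n \<and> xs = ys"
proof (induction m arbitrary: n rule: nat_code.induct)
  case (1 m)
  show ?case
  proof (cases "m = 0 \<or> n = 0")
    case True
    with "1.prems" show ?thesis
      by (auto simp: nat_code.simps[of m] nat_code.simps[of n] split: if_splits)
  next
    case False
    with "1.prems" have "odd m = odd n" "nat_code (m div 2) @ xs = nat_code (n div 2) @ ys"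
      by (auto simp: nat_code.simps[of m] nat_code.simps[of n])
    with False "1.IH" have "m div 2 = n div 2" "xs = ys" by blast+
    with \<open>odd m = odd n\<close> show ?thesis by (metis bit_eq_rec)
  qed
qed

lemma length_nat_code: "n < 2 ^ k \<Longrightarrow> length (nat_code n) \<le> 2 * k + 1"
proof (induction k arbitrary: n)
  case 0
  then show ?case by (simp add: nat_code.simps)
next
  case (Suc k)
  then have "n div 2 < 2 ^ k" by auto
  from Suc.IH[OF this] show ?case by (simp add: nat_code.simps[of n])
qed

text \<open>Prefix-freeness allows the first number to be split off uniquely, and nonempty code
  words exclude that one list is a proper prefix of the other.\<close>

lemma inj_concat_nat_code: "inj (\<lambda>xs. concat (map nat_code xs))"
proof (rule injI)
  have ne: "nat_code n \<noteq> []" for n by (simp add: nat_code.simps)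
  show "xs = ys" if "concat (map nat_code xs) = concat (map nat_code ys)" for xs ys
    using that
  proof (induction xs arbitrary: ys)
    case Nil
    then show ?case using ne by (cases ys) auto
  next
    case (Cons x xs)
    then obtain y ys' where ys: "ys = y # ys'" using ne by (cases ys) auto
    with Cons.prems have "nat_code x @ concat (map nat_code xs) = nat_code y @ concat (map nat_code ys')"
      by simp
    then have "x = y" "concat (map nat_code xs) = concat (map nat_code ys')"
      by (blast dest: nat_code_prefix_free)+
    with Cons.IH ys show ?case by auto
  qed
qed

text \<open>Reduces the task to labels made of boundedly many numbers of size at most the number of
  vertices. Each number costs O(log n) bits, and the single decoder \<open>inv e\<close> works for
  all graphs of the class.\<close>

lemma implicit_representation_by_numbers:
  fixes \<X> :: "'a pair_pre_digraph set" and g :: "nat list \<Rightarrow> nat list \<Rightarrow> bool"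
  assumes "\<And>G. G \<in> \<X> \<Longrightarrow> card (pverts G) \<ge> 2 \<Longrightarrow>
    \<exists>L. (\<forall>x\<in>pverts G. length (L x) \<le> K \<and> (\<forall>i\<in>set (L x). i \<le> card (pverts G))) \<and>
        (\<forall>x\<in>pverts G. \<forall>y\<in>pverts G. x \<noteq> y \<longrightarrow> ((x, y) \<in> parcs G \<longleftrightarrow> g (L x) (L y)))"
  shows "admits_implicit_representation \<X>"
proof -
  define e where "e = (\<lambda>xs. concat (map nat_code xs))"
  have inv_e: "inv e (e xs) = xs" for xs
    unfolding e_def by (rule inv_f_f[OF inj_concat_nat_code])
  have "\<exists>l. (\<forall>x\<in>pverts G. real (length (l x)) \<le> real (5 * K) * log 2 (real (card (pverts G)))) \<and>
            (\<forall>x\<in>pverts G. \<forall>y\<in>pverts G. x \<noteq> y \<longrightarrow>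
               ((x, y) \<in> parcs G \<longleftrightarrow> g (inv e (l x)) (inv e (l y))))"
    if G: "G \<in> \<X>" "card (pverts G) \<ge> 2" for G
  proof -
    define n where "n = card (pverts G)"
    obtain L where L: "\<And>x. x \<in> pverts G \<Longrightarrow> length (L x) \<le> K"
        "\<And>x i. x \<in> pverts G \<Longrightarrow> i \<in> set (L x) \<Longrightarrow> i \<le> n"
        "\<forall>x\<in>pverts G. \<forall>y\<in>pverts G. x \<noteq> y \<longrightarrow> ((x, y) \<in> parcs G \<longleftrightarrow> g (L x) (L y))"
      using assms[OF G] unfolding n_def by auto
    \<comment> \<open>All numbers up to and including \<open>n\<close> have at most
      \<open>k + 1\<close> binary digits, hence codes of length at most
      \<open>2 * k + 3\<close>.\<close>
    define k where "k = nat \<lfloor>log 2 (real n)\<rfloor>"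
    have log1: "log 2 (real n) \<ge> 1" using G by (simp add: n_def le_log_iff)
    have "log 2 (real n) < real k + 1" using log1 unfolding k_def by linarith
    then have "real n < 2 powr (real k + 1)" using G by (simp add: n_def log_less_iff)
    also have "\<dots> = real (2 ^ (k + 1))" by (simp add: powr_add powr_realpow)
    finally have n_less: "n < 2 ^ (k + 1)" by linarith
    have bound: "real (length (e (L x))) \<le> real (5 * K) * log 2 (real n)" if x: "x \<in> pverts G" for x
    proof -
      have "length (e (L x)) = (\<Sum>i\<leftarrow>L x. length (nat_code i))"
        by (simp add: e_def length_concat comp_def)
      also have "\<dots> \<le> (\<Sum>i\<leftarrow>L x. 2 * (k + 1) + 1)"
        using L(2)[OF x] n_less by (intro sum_list_mono length_nat_code) fastforce
      also have "\<dots> = length (L x) * (2 * k + 3)" by (simp add: sum_list_triv algebra_simps)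
      also have "\<dots> \<le> K * (2 * k + 3)" using L(1)[OF x] by (rule mult_right_mono) simp
      finally have "real (length (e (L x))) \<le> real K * (2 * real k + 3)"
        by (metis (mono_tags) of_nat_add of_nat_le_iff of_nat_mult of_nat_numeral)
      \<comment> \<open>The constant 5 arises as 2 + 3, since \<open>k\<close> is at most the
        logarithm and the logarithm is at least 1 for \<open>n\<close> at least 2.\<close>
      also have "\<dots> \<le> real K * (5 * log 2 (real n))"
        using log1 unfolding k_def by (intro mult_left_mono) linarith+
      finally show ?thesis by simp
    qed
    with L(3) show ?thesis
      by (intro exI[of _ "\<lambda>x. e (L x)"]) (auto simp: inv_e n_def)
  qed
  then show ?thesis unfolding admits_implicit_representation_def
    by (intro exI[of _ "real (5 * K)"] exI[of _ "\<lambda>a b. g (inv e a) (inv e b)"]) auto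
qed

section \<open>Labels from a partition without unbalanced double stars\<close>

text \<open>If both differences of two rows are large, they contain the leaves of a double star
  centred at these rows. The maximum with 1 makes the differences nonempty, so the two centres are
  distinct even for \<open>p = 0\<close>.\<close>

lemma no_double_star_almost_nested:
  assumes fin: "finite B"
    and no_star: "\<not> unbalanced_double_star (bipartite_between G A B) A B p"
  shows "almost_nested (max p 1) (\<lambda>a b. (a, b) \<in> parcs G) A B"
  unfolding almost_nested_def
proof (intro ballI, rule ccontr)
  fix a a' assume a: "a \<in> A" "a' \<in> A"
  let ?N = "{b\<in>B. (a, b) \<in> parcs G \<and> (a', b) \<notin> parcs G}"
  let ?N' = "{b\<in>B. (a', b) \<in> parcs G \<and> (a, b) \<notin> parcs G}"
  assume "\<not> (card ?N < max p 1 \<or> card ?N' < max p 1)"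
  then have large: "p \<le> card ?N" "p \<le> card ?N'" "1 \<le> card ?N" by auto
  then have ne: "?N \<noteq> {}" by (metis card.empty not_one_le_zero)
  obtain S where S: "S \<subseteq> ?N" "card S = p" "finite S"
    using large(1) by (rule obtain_subset_with_card_n)
  obtain S' where S': "S' \<subseteq> ?N'" "card S' = p" "finite S'"
    using large(2) by (rule obtain_subset_with_card_n)
  have "a \<noteq> a'" "S \<inter> S' = {}" "S \<subseteq> B" "S' \<subseteq> B" using ne S(1) S'(1) by auto
  moreover have "\<forall>s\<in>S. (a, s) \<in> parcs (bipartite_between G A B) \<and> (a', s) \<notin> parcs (bipartite_between G A B)"
    "\<forall>s\<in>S'. (a', s) \<in> parcs (bipartite_between G A B) \<and> (a, s) \<notin> parcs (bipartite_between G A B)"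
    using S(1) S'(1) a by (auto simp: bipartite_between_def)
  ultimately have "unbalanced_double_star (bipartite_between G A B) A B p"
    unfolding unbalanced_double_star_def using a S(2,3) S'(2,3)
    by (intro bexI[of _ "(A, B)"]) blast+
  with no_star show False by blast
qed

text \<open>
  A label is the vertex number, the number of its part, a bit telling whether this part is a clique,
  one threshold for each of at most \<open>k\<close> parts, and the numbers of the exceptional vertices.
\<close>

definition decode_ordered :: "nat \<Rightarrow> nat list \<Rightarrow> nat list \<Rightarrow> bool" where
  "decode_ordered k xs ys \<longleftrightarrow>
     ((xs ! (3 + ys ! 1) \<le> ys ! (3 + xs ! 1)) \<noteq>
      (ys ! 0 \<in> set (drop (3 + k) xs) \<or> xs ! 0 \<in> set (drop (3 + k) ys)))"

text \<open>Row and column thresholds are not interchangeable, so the vertex in the part of smaller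
  number always acts as the row.\<close>

definition decode :: "nat \<Rightarrow> nat list \<Rightarrow> nat list \<Rightarrow> bool" where
  "decode k xs ys \<longleftrightarrow>
     (if xs ! 1 = ys ! 1 then xs ! 2 = 1
      else if xs ! 1 < ys ! 1 then decode_ordered k xs ys else decode_ordered k ys xs)"

text \<open>The final inequality lets part numbers serve as label entries. It holds because parts
  are nonempty, so \<open>c\<close> reaches every part number.\<close>

lemma partition_enumeration:
  assumes "partition_on V P" "finite V" "finite P"
  shows "\<exists>q c. (\<forall>i<card P. q i \<in> P) \<and> inj_on q {..<card P} \<and>
    (\<forall>x\<in>V. c x < card P) \<and> (\<forall>x\<in>V. \<forall>i<card P. x \<in> q i \<longleftrightarrow> c x = i) \<and> card P \<le> card V"
proof -
  obtain q where q: "bij_betw q {..<card P} P"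
    using ex_bij_betw_nat_finite[OF assms(3)] by (auto simp: atLeast0LessThan)
  have "\<exists>i<card P. x \<in> q i" if "x \<in> V" for x
  proof -
    obtain A where "A \<in> P" "x \<in> A" using assms(1) \<open>x \<in> V\<close> by (auto simp: partition_on_def)
    then show ?thesis using q by (auto simp: bij_betw_def)
  qed
  then obtain c where c: "\<And>x. x \<in> V \<Longrightarrow> c x < card P" "\<And>x. x \<in> V \<Longrightarrow> x \<in> q (c x)" by metis
  have c_eq: "c x = i" if "x \<in> V" "x \<in> q i" "i < card P" for x i
  proof -
    have "q (c x) \<in> P" "q i \<in> P" using q c that by (auto simp: bij_betw_def)
    then have "q (c x) = q i"
      using disjointD[OF partition_onD2[OF assms(1)], of "q (c x)" "q i"] c(2) that by blast
    then show ?thesis using q c that by (auto simp: bij_betw_def inj_on_def)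
  qed
  have "{..<card P} \<subseteq> c ` V"
  proof
    fix i assume i: "i \<in> {..<card P}"
    then have "q i \<in> P" using q by (auto simp: bij_betw_def)
    then obtain x where "x \<in> q i" "x \<in> V"
      using assms(1) by (metis partition_onD1 partition_onD3 UnionI all_not_in_conv)
    then show "i \<in> c ` V" using c_eq i by blast
  qed
  then have "card {..<card P} \<le> card V" by (rule surj_card_le[OF assms(2)])
  moreover have "\<forall>i<card P. q i \<in> P" "inj_on q {..<card P}" using q by (auto simp: bij_betw_def)
  moreover have "\<forall>x\<in>V. \<forall>i<card P. x \<in> q i \<longleftrightarrow> c x = i" using c c_eq by blast
  ultimately show ?thesis using c by (intro exI[of _ q] exI[of _ c]) auto
qed

text \<open>The length bound adds three leading entries, \<open>k\<close> thresholds, and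
  \<open>4 * max p 1\<close> exceptions for each of at most \<open>k\<close> parts.\<close>

lemma double_star_labels:
  fixes G :: "'a pair_pre_digraph"
  assumes "pair_graph G" and n: "card (pverts G) \<ge> 2"
    and P: "partition_on (pverts G) P" "finite P" "card P \<le> k"
    and hom: "\<forall>S\<in>P. homogeneous G S"
    and no_star: "\<forall>A\<in>P. \<forall>B\<in>P. A \<noteq> B \<longrightarrow> \<not> unbalanced_double_star (bipartite_between G A B) A B p"
  shows "\<exists>L. (\<forall>x\<in>pverts G. length (L x) \<le> 3 + k + k * (4 * max p 1) \<and>
                 (\<forall>i\<in>set (L x). i \<le> card (pverts G))) \<and>
        (\<forall>x\<in>pverts G. \<forall>y\<in>pverts G. x \<noteq> y \<longrightarrow> ((x, y) \<in> parcs G \<longleftrightarrow> decode k (L x) (L y)))"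
proof -
  interpret pair_graph G by fact
  let ?V = "pverts G" and ?R = "\<lambda>x y. (x, y) \<in> parcs G"
  define m where "m = max p 1"
  have finV: "finite ?V" by (rule pair_finite_verts)
  have sym: "?R x y \<longleftrightarrow> ?R y x" for x y by (auto intro: arcs_symmetric)
  obtain q c where q: "\<And>i. i < card P \<Longrightarrow> q i \<in> P" "inj_on q {..<card P}"
    and c: "\<And>x. x \<in> ?V \<Longrightarrow> c x < card P"
    and qc: "\<And>x i. x \<in> ?V \<Longrightarrow> i < card P \<Longrightarrow> x \<in> q i \<longleftrightarrow> c x = i"
    and cardP: "card P \<le> card ?V"
    using partition_enumeration[OF P(1) finV P(2)] by metis
  have qV: "q i \<subseteq> ?V" if "i < card P" for i
    using q(1)[OF that] P(1) by (auto simp: partition_on_def)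
  have finq: "finite (q i)" and card_q: "card (q i) \<le> card ?V" if "i < card P" for i
    using qV[OF that] finV by (auto intro: finite_subset card_mono)
  have nested: "almost_nested m ?R (q i) (q j)" if "i < card P" "j < card P" "i \<noteq> j" for i j
  proof -
    have "q i \<noteq> q j" using q(2) that by (auto simp: inj_on_def)
    with q(1) that no_star have "\<not> unbalanced_double_star (bipartite_between G (q i) (q j)) (q i) (q j) p"
      by blast
    then show ?thesis unfolding m_def by (rule no_double_star_almost_nested[OF finq[OF that(2)]])
  qed
  have "\<exists>u v S T. threshold_scheme (4 * m) ?R (q i) (q j) u v S T"
    if ij: "i < j" "j < card P" for i j
  proof (rule threshold_with_exceptions)
    show "finite (q i)" "finite (q j)" "almost_nested m ?R (q i) (q j)"
      using finq nested ij by auto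
    have "almost_nested m ?R (q j) (q i)" using nested ij by auto
    then show "almost_nested m (\<lambda>b a. ?R a b) (q j) (q i)"
      by (simp add: almost_nested_def sym)
  qed
  then obtain u v S T where scheme: "\<And>i j. i < j \<Longrightarrow> j < card P \<Longrightarrow>
      threshold_scheme (4 * m) ?R (q i) (q j) (u i j) (v i j) (S i j) (T i j)"
    by metis
  have uv: "a \<in> q i \<Longrightarrow> u i j a \<le> card (q j)" "b \<in> q j \<Longrightarrow> v i j b \<le> card (q j)"
    and S: "card (S i j a) \<le> 4 * m" "S i j a \<subseteq> q j"
    and T: "card (T i j b) \<le> 4 * m" "T i j b \<subseteq> q i"
    and R: "a \<in> q i \<Longrightarrow> b \<in> q j \<Longrightarrow>
      ?R a b \<longleftrightarrow> ((u i j a \<le> v i j b) \<noteq> (b \<in> S i j a \<or> a \<in> T i j b))"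
    if "i < j" "j < card P" for i j a b
    using scheme[OF that] unfolding threshold_scheme_def by simp_all
  \<comment> \<open>The filler 0 stands for the own part of \<open>x\<close> and for numbers that
    belong to no part. It gives every label exactly \<open>k\<close> thresholds, so the exceptions
    start at position \<open>3 + k\<close>.\<close>
  define thr where "thr x j =
    (if j \<ge> card P then 0 else if c x < j then u (c x) j x else if j < c x then v j (c x) x else 0)" for x j
  define W where "W x j = (if c x < j then S (c x) j x else if j < c x then T j (c x) x else {})" for x j
  define X where "X x = (\<Union>j<card P. W x j)" for x
  have thr_le: "thr x j \<le> card ?V" if "x \<in> ?V" for x j
  proof -
    have "u (c x) j x \<le> card ?V" if "c x < j" "j < card P"
      using that uv(1) qc[OF \<open>x \<in> ?V\<close> c[OF \<open>x \<in> ?V\<close>]] card_q[of j] by (meson le_trans)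
    moreover have "v j (c x) x \<le> card ?V" if "j < c x"
      using that uv(2) qc[OF \<open>x \<in> ?V\<close> c[OF \<open>x \<in> ?V\<close>]] card_q[of "c x"] c[OF \<open>x \<in> ?V\<close>] by (meson le_trans)
    ultimately show ?thesis by (auto simp: thr_def)
  qed
  have W: "W x j \<subseteq> q j" "card (W x j) \<le> 4 * m" if "x \<in> ?V" "j < card P" for x j
    using that S T c by (auto simp: W_def)
  have XV: "X x \<subseteq> ?V" if "x \<in> ?V" for x using W(1)[OF that] qV by (fastforce simp: X_def)
  have finX: "finite (X x)" if "x \<in> ?V" for x using XV[OF that] finV by (rule finite_subset)
  \<comment> \<open>Merging the exceptions over all parts loses nothing: parts are disjoint, so
    \<open>y\<close> can only come from the set for its own part.\<close>
  have X_iff: "y \<in> X x \<longleftrightarrow> y \<in> W x (c y)" if "x \<in> ?V" "y \<in> ?V" for x y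
    using W(1)[OF that(1)] qc[OF that(2)] c[OF that(2)] by (fastforce simp: X_def)
  have card_X: "card (X x) \<le> k * (4 * m)" if "x \<in> ?V" for x
  proof -
    have "card (X x) \<le> (\<Sum>j<card P. card (W x j))" unfolding X_def by (rule card_UN_le) simp
    also have "\<dots> \<le> card P * (4 * m)"
      using sum_bounded_above[of "{..<card P}" "\<lambda>j. card (W x j)" "4 * m"] W(2)[OF that] by simp
    also have "\<dots> \<le> k * (4 * m)" using P(3) by (rule mult_right_mono) simp
    finally show ?thesis .
  qed
  obtain num where num: "bij_betw num ?V {..<card ?V}"
    using ex_bij_betw_finite_nat[OF finV] by (auto simp: atLeast0LessThan)
  have num_less: "num x < card ?V" if "x \<in> ?V" for x using num that by (auto simp: bij_betw_def)
  define clique where "clique i = (if \<forall>x\<in>q i. \<forall>y\<in>q i. x \<noteq> y \<longrightarrow> ?R x y then 1 else 0 :: nat)" for i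
  define L where "L x = [num x, c x, clique (c x)] @ map (thr x) [0..<k] @
    sorted_list_of_set (num ` X x)" for x
  have L_simps: "L x ! 0 = num x" "L x ! 1 = c x" "L x ! 2 = clique (c x)"
    "j < k \<Longrightarrow> L x ! (3 + j) = thr x j"
    "drop (3 + k) (L x) = sorted_list_of_set (num ` X x)" for x j
    by (simp_all add: L_def nth_append numeral_3_eq_3)
  have L_X: "num y \<in> set (drop (3 + k) (L x)) \<longleftrightarrow> y \<in> X x" if "x \<in> ?V" "y \<in> ?V" for x y
    using finX[OF that(1)] XV[OF that(1)] that num unfolding L_simps
    by (auto simp: bij_betw_def inj_on_def)
  have len: "length (L x) \<le> 3 + k + k * (4 * m)" if "x \<in> ?V" for x
    using card_X[OF that] card_image_le[OF finX[OF that], of num] by (simp add: L_def)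
  have entries: "i \<le> card ?V" if "x \<in> ?V" "i \<in> set (L x)" for x i
  proof -
    have "num y \<le> card ?V" if "y \<in> X x" for y
      using XV[OF \<open>x \<in> ?V\<close>] num_less that by (auto intro: less_imp_le)
    then show ?thesis
      using that finX[OF that(1)] num_less[OF that(1)] c[OF that(1)] cardP n thr_le[OF that(1)]
      by (auto simp: L_def clique_def split: if_splits)
  qed
  have ordered: "?R x y \<longleftrightarrow> decode_ordered k (L x) (L y)"
    if xy: "x \<in> ?V" "y \<in> ?V" "c x < c y" for x y
  proof -
    have lt: "c x < k" "c y < k" "c x < card P" "c y < card P" using c[of x] c[of y] xy P(3) by auto
    have "decode_ordered k (L x) (L y) \<longleftrightarrow>
        ((thr x (c y) \<le> thr y (c x)) \<noteq> (y \<in> W x (c y) \<or> x \<in> W y (c x)))"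
      unfolding decode_ordered_def using lt xy L_X X_iff by (simp only: L_simps(1,2,4))
    also have "\<dots> \<longleftrightarrow> ?R x y"
      using R[of "c x" "c y" x y] lt xy qc by (simp add: thr_def W_def)
    finally show ?thesis by simp
  qed
  have same: "?R x y \<longleftrightarrow> clique (c x) = 1" if xy: "x \<in> ?V" "y \<in> ?V" "x \<noteq> y" "c x = c y" for x y
  proof -
    have "x \<in> q (c x)" "y \<in> q (c x)" using qc c xy by auto
    moreover have "homogeneous G (q (c x))" using hom q c xy by auto
    ultimately show ?thesis using xy(3) by (auto simp: homogeneous_def clique_def)
  qed
  have "?R x y \<longleftrightarrow> decode k (L x) (L y)" if xy: "x \<in> ?V" "y \<in> ?V" "x \<noteq> y" for x y
  proof (cases "c x" "c y" rule: linorder_cases)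
    case less
    then show ?thesis using ordered[OF xy(1,2)] unfolding decode_def L_simps(2,3) by simp
  next
    case equal
    then show ?thesis using same[OF xy] unfolding decode_def L_simps(2,3) by simp
  next
    case greater
    then show ?thesis using ordered[OF xy(2,1)] sym[of x y] unfolding decode_def L_simps(2,3) by simp
  qed
  with len entries show ?thesis unfolding m_def by (intro exI[of _ L]) blast
qed

lemma double_star_implicit_representation:
  assumes "\<And>G. G \<in> \<X> \<Longrightarrow> pair_graph G" and "bounded_double_star_partition_number \<X>"
  shows "admits_implicit_representation \<X>"
proof -
  obtain k p where kp: "\<And>G. G \<in> \<X> \<Longrightarrow> \<exists>P. partition_on (pverts G) P \<and> finite P \<and> card P \<le> k \<and>
        (\<forall>S\<in>P. homogeneous G S) \<and>
        (\<forall>A\<in>P. \<forall>B\<in>P. A \<noteq> B \<longrightarrow> \<not> unbalanced_double_star (bipartite_between G A B) A B p)"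
    using assms(2) unfolding bounded_double_star_partition_number_def by blast
  show ?thesis
  proof (rule implicit_representation_by_numbers[where g = "decode k" and K = "3 + k + k * (4 * max p 1)"])
    fix G assume G: "G \<in> \<X>" "2 \<le> card (pverts G)"
    from kp[OF G(1)] double_star_labels[OF assms(1)[OF G(1)] G(2)]
    show "\<exists>L. (\<forall>x\<in>pverts G. length (L x) \<le> 3 + k + k * (4 * max p 1) \<and>
                 (\<forall>i\<in>set (L x). i \<le> card (pverts G))) \<and>
        (\<forall>x\<in>pverts G. \<forall>y\<in>pverts G. x \<noteq> y \<longrightarrow> ((x, y) \<in> parcs G \<longleftrightarrow> decode k (L x) (L y)))"
      by blast
  qed
qed

section \<open>Graphs of bounded h-index\<close>

text \<open>Otherwise some \<open>Suc (h_index G)\<close> of these vertices would all have degree at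
  least \<open>Suc (h_index G)\<close>, against maximality.\<close>

lemma (in pair_graph) card_large_degree_le_h_index:
  "card {v\<in>pverts G. h_index G < out_degree (with_proj G) v} \<le> h_index G"
proof (rule ccontr)
  let ?h = "h_index G" and ?H = "{v\<in>pverts G. h_index G < out_degree (with_proj G) v}"
  assume "\<not> card ?H \<le> ?h"
  then have "Suc ?h \<le> card ?H" by simp
  then obtain S where S: "S \<subseteq> ?H" "card S = Suc ?h" "finite S"
    by (rule obtain_subset_with_card_n)
  have "Suc ?h \<le> h_index G"
    unfolding h_index_def[of G]
  \<comment> \<open>The greatest value is well defined because a witnessing set has at most
    \<open>card (pverts G)\<close> elements.\<close>
  proof (rule Greatest_le_nat[where b = "card (pverts G)"])
    show "\<exists>T\<subseteq>pverts G. finite T \<and> card T = Suc (GREATEST k. \<exists>S\<subseteq>pverts G. finite S \<and> card S = k \<and>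
       (\<forall>v\<in>S. k \<le> out_degree (with_proj G) v)) \<and>
       (\<forall>v\<in>T. Suc (GREATEST k. \<exists>S\<subseteq>pverts G. finite S \<and> card S = k \<and>
       (\<forall>v\<in>S. k \<le> out_degree (with_proj G) v)) \<le> out_degree (with_proj G) v)"
      unfolding h_index_def[symmetric] using S by (intro exI[of _ S]) auto
  qed (auto intro: card_mono pair_finite_verts)
  then show False by simp
qed

lemma (in pair_graph) out_degree_eq_card_neighbours:
  "out_degree (with_proj G) v = card {w. (v, w) \<in> parcs G}"
proof -
  have "out_arcs (with_proj G) v = Pair v ` {w. (v, w) \<in> parcs G}" by (auto simp: out_arcs_def)
  then show ?thesis by (simp add: out_degree_def card_image inj_on_def)
qed

lemma h_index_implicit_representation:
  fixes \<X> :: "'a pair_pre_digraph set"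
  assumes graphs: "\<And>G. G \<in> \<X> \<Longrightarrow> pair_graph G" and "bounded_h_index \<X>"
  shows "admits_implicit_representation \<X>"
proof -
  obtain k where k: "\<And>G. G \<in> \<X> \<Longrightarrow> h_index G \<le> k"
    using assms(2) unfolding bounded_h_index_def by blast
  define g :: "nat list \<Rightarrow> nat list \<Rightarrow> bool" where
    "g xs ys \<longleftrightarrow> hd ys \<in> set (tl xs) \<or> hd xs \<in> set (tl ys)" for xs ys
  show ?thesis
  proof (rule implicit_representation_by_numbers[where g = g and K = "Suc k"])
    fix G assume G: "G \<in> \<X>"
    interpret pair_graph G using graphs[OF G] .
    let ?V = "pverts G"
    define H where "H = {v\<in>?V. h_index G < out_degree (with_proj G) v}"
    define N where "N x = {y. (x, y) \<in> parcs G}" for x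
    \<comment> \<open>Either choice has at most \<open>k\<close> elements: \<open>H\<close> itself
      is that small, and a vertex outside \<open>H\<close> has degree at most
      \<open>h_index G\<close>.\<close>
    define M where "M x = (if x \<in> H then N x \<inter> H else N x)" for x
    have fin: "finite ?V" by (rule pair_finite_verts)
    have NV: "N x \<subseteq> ?V" for x unfolding N_def using arc_snd_in_verts by fastforce
    then have MV: "M x \<subseteq> ?V" for x by (auto simp: M_def)
    then have finM: "finite (M x)" for x using fin by (rule finite_subset)
    have "finite H" using fin by (simp add: H_def)
    have "card H \<le> k" unfolding H_def using card_large_degree_le_h_index k[OF G] by (rule le_trans)
    have card_M: "card (M x) \<le> k" if "x \<in> ?V" for x
    proof (cases "x \<in> H")
      case True
      then have "card (M x) \<le> card H" using \<open>finite H\<close> by (intro card_mono) (auto simp: M_def)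
      with \<open>card H \<le> k\<close> show ?thesis by simp
    next
      case False
      then show ?thesis
        using that k[OF G] by (simp add: M_def N_def H_def out_degree_eq_card_neighbours)
    qed
    obtain num where num: "bij_betw num ?V {..<card ?V}"
      using ex_bij_betw_finite_nat[OF fin] by (auto simp: atLeast0LessThan)
    define L where "L x = num x # sorted_list_of_set (num ` M x)" for x
    have num_M: "num y \<in> num ` M x \<longleftrightarrow> y \<in> M x" if "y \<in> ?V" for x y
      using that MV[of x] num by (auto simp: bij_betw_def inj_on_def)
    have num_le: "num x \<le> card ?V" if "x \<in> ?V" for x
      using num that by (auto simp: bij_betw_def intro: less_imp_le)
    have "length (L x) \<le> Suc k" if "x \<in> ?V" for x
      using card_M[OF that] card_image_le[OF finM, of num x] by (simp add: L_def)
    moreover have "i \<le> card ?V" if "x \<in> ?V" "i \<in> set (L x)" for x i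
      using that finM[of x] MV[of x] num_le by (auto simp: L_def)
    moreover have "(x, y) \<in> parcs G \<longleftrightarrow> g (L x) (L y)" if "x \<in> ?V" "y \<in> ?V" for x y
    proof -
      have "g (L x) (L y) \<longleftrightarrow> y \<in> M x \<or> x \<in> M y"
        using that finM by (simp add: g_def L_def num_M)
      \<comment> \<open>An edge inside \<open>H\<close> is stored at both ends, and any other edge
        at an end outside \<open>H\<close>.\<close>
      also have "\<dots> \<longleftrightarrow> (x, y) \<in> parcs G"
        using arcs_symmetric by (auto simp: M_def N_def)
      finally show ?thesis by simp
    qed
    ultimately show "\<exists>L. (\<forall>x\<in>?V. length (L x) \<le> Suc k \<and> (\<forall>i\<in>set (L x). i \<le> card ?V)) \<and>
        (\<forall>x\<in>?V. \<forall>y\<in>?V. x \<noteq> y \<longrightarrow> ((x, y) \<in> parcs G \<longleftrightarrow> g (L x) (L y)))"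
      by (intro exI[of _ L]) blast
  qed
qed

theorem corollary2:
  fixes \<X> :: "'a pair_pre_digraph set"
  assumes "\<And>G. G \<in> \<X> \<Longrightarrow> pair_graph G"
  shows "(bounded_double_star_partition_number \<X> \<longrightarrow> admits_implicit_representation \<X>) \<and>
         (bounded_h_index \<X> \<longrightarrow> admits_implicit_representation \<X>)"
  using assms double_star_implicit_representation h_index_implicit_representation by blast

end
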